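(* Let $N\ge 2$, let $0<\delta\le 1$ be a real number, and let $\mathcal{E}$ be a bipartite quantum measure satisfying the generalized polygamy relation $$\mathcal{E}^{\delta}(\rho_{A|B_1\cdots B_{N-1}})\ \le\ \sum_{i=1}^{N-1}\mathcal{E}^{\delta}(\rho_{AB_i})$$ for $N$-qubit states. Let $\rho_{AB_1\cdots B_{N-1}}$ be any $N$-qubit state, and let $\mathcal{E}_1\ge\mathcal{E}_2\ge\cdots\ge\mathcal{E}_{N-1}$ be the numbers $\mathcal{E}_{AB_1},\dots,\mathcal{E}_{AB_{N-1}}$ arranged in descending order. If $a\ge 1$ is a real number such that $\mathcal{E}_i^{\delta}\ge a\,\mathcal{E}_{i+1}^{\delta}$ for $i=1,\dots,N-2$, then for all real $\beta\ge\delta$ and all real $s>0$, $$\mathcal{E}_{A|B_1\cdots B_{N-1}}^{\beta}\ \le\ \left(1+\frac{a}{s}\right)^{\frac{\beta}{\delta}-1}\sum_{i=1}^{N-1}\left(\left(1+\frac{s}{a}\right)^{\frac{\beta}{\delta}-1}\right)^{N-1-i}\mathcal{E}_i^{\beta}.$$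
   Context: A state on a Hilbert space is a density matrix (positive semidefinite operator of trace $1$). A bipartite quantum measure (measure of quantum correlation) $\mathcal{E}$ assigns a nonnegative real number to each bipartite state. For an $N$-partite state $\rho=\rho_{AB_1\cdots B_{N-1}}$ on $\mathcal{H}_A\otimes\mathcal{H}_{B_1}\otimes\cdots\otimes\mathcal{H}_{B_{N-1}}$ (each factor $\mathbb{C}^2$ in the $N$-qubit case), $\rho_{AB_i}$ denotes the reduced density matrix obtained by tracing out all $B_j$ with $j\ne i$, and $\rho_{A|B_1\cdots B_{N-1}}$ denotes $\rho$ viewed as a bipartite state on $\mathcal{H}_A\otimes(\mathcal{H}_{B_1}\otimes\cdots\otimes\mathcal{H}_{B_{N-1}})$. Notation: $\mathcal{E}_{AB_i}=\mathcal{E}(\rho_{AB_i})$ and $\mathcal{E}_{A|B_1\cdots B_{N-1}}=\mathcal{E}(\rho_{A|B_1\cdots B_{N-1}})$. Superscripts on $\mathcal{E}$ are powers. *)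

theory Defs
  imports "HOL-Combinatorics.Permutations" "Jordan_Normal_Form.Matrix"
begin

(* States on the Hilbert space C^d.  The order on complex is that of HOL-Library.Complex_Order, so
   0 \<le> z says that z is real and nonnegative; over C this makes \<rho> self-adjoint as well. *)
definition density_matrix :: "nat \<Rightarrow> complex mat \<Rightarrow> bool" where
  "density_matrix d \<rho> \<longleftrightarrow>
     \<rho> \<in> carrier_mat d d \<and>
     (\<forall>v \<in> carrier_vec d. 0 \<le> (\<rho> *\<^sub>v v) \<bullet>c v) \<and>
     (\<Sum>x<d. \<rho> $$ (x, x)) = 1"

(* E dA dB \<rho> is the value of the measure on the state \<rho> of C^dA \<otimes> C^dB, written as a matrix in the
   lexicographically ordered product basis: the basis vector e_a \<otimes> e_b has index a * dB + b.
   Values of E at matrices that are not states are irrelevant. *)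
definition bipartite_measure :: "(nat \<Rightarrow> nat \<Rightarrow> complex mat \<Rightarrow> real) \<Rightarrow> bool" where
  "bipartite_measure E \<longleftrightarrow>
     (\<forall>dA dB \<rho>. density_matrix (dA * dB) \<rho> \<longrightarrow> 0 \<le> E dA dB \<rho>)"

(* The N qubits are numbered 0, ..., N-1: qubit 0 is A and qubit i is B_i.  A product basis vector
   of their tensor product is indexed by the number x < 2^N whose binary digits, most significant
   first, are the values of the qubits 0, ..., N-1. *)
definition qubit_value :: "nat \<Rightarrow> nat \<Rightarrow> nat \<Rightarrow> nat" where
  "qubit_value N k x = x div 2 ^ (N - 1 - k) mod 2"

(* \<rho>_{AB_i}: the partial trace over all B_j with j \<noteq> i.  The index r < 4 of a product basis vector
   of A \<otimes> B_i has the A-value r div 2 and the B_i-value r mod 2. *)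
definition reduced_AB :: "nat \<Rightarrow> nat \<Rightarrow> complex mat \<Rightarrow> complex mat" where
  "reduced_AB N i \<rho> = mat 4 4 (\<lambda>(r, c).
     \<Sum>(x, y) \<in> {(x, y). x < 2 ^ N \<and> y < 2 ^ N \<and>
         qubit_value N 0 x = r div 2 \<and> qubit_value N i x = r mod 2 \<and>
         qubit_value N 0 y = c div 2 \<and> qubit_value N i y = c mod 2 \<and>
         (\<forall>j \<in> {1..<N} - {i}. qubit_value N j x = qubit_value N j y)}.
       \<rho> $$ (x, y))"

(* \<E>_{AB_i} = \<E>(\<rho>_{AB_i}) *)
definition measure_AB ::
  "(nat \<Rightarrow> nat \<Rightarrow> complex mat \<Rightarrow> real) \<Rightarrow> nat \<Rightarrow> nat \<Rightarrow> complex mat \<Rightarrow> real" where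
  "measure_AB E N i \<rho> = E 2 2 (reduced_AB N i \<rho>)"

(* \<E>_{A|B_1...B_{N-1}}: with A as the leading digit, the N-qubit matrix is already, entry for entry,
   the matrix of the bipartite state on C^2 \<otimes> C^(2^(N-1)). *)
definition measure_A_rest ::
  "(nat \<Rightarrow> nat \<Rightarrow> complex mat \<Rightarrow> real) \<Rightarrow> nat \<Rightarrow> complex mat \<Rightarrow> real" where
  "measure_A_rest E N \<rho> = E 2 (2 ^ (N - 1)) \<rho>"

definition polygamous ::
  "(nat \<Rightarrow> nat \<Rightarrow> complex mat \<Rightarrow> real) \<Rightarrow> nat \<Rightarrow> real \<Rightarrow> bool" where
  "polygamous E N \<delta> \<longleftrightarrow>
     (\<forall>\<rho>. density_matrix (2 ^ N) \<rho> \<longrightarrow>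
        measure_A_rest E N \<rho> powr \<delta> \<le> (\<Sum>i = 1..N - 1. measure_AB E N i \<rho> powr \<delta>))"

lemma qubit_value_lt_2 [simp]: "qubit_value N k x < 2"
  by (simp add: qubit_value_def)

lemma qubit_value_inj:
  assumes "x < 2 ^ N" "y < 2 ^ N" "\<And>k. k < N \<Longrightarrow> qubit_value N k x = qubit_value N k y"
  shows "x = y"
proof (rule bit_eqI)
  fix n
  show "bit x n \<longleftrightarrow> bit y n"
  proof (cases "n < N")
    case True
    then have "x div 2 ^ n mod 2 = y div 2 ^ n mod 2"
      using assms(3)[of "N - 1 - n"] by (simp add: qubit_value_def)
    then show ?thesis by (simp add: bit_iff_odd odd_iff_mod_2_eq_one)
  next
    case False
    then have "x < 2 ^ n" "y < 2 ^ n"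
      using assms(1,2) power_increasing[of N n "2::nat"] by (auto intro: less_le_trans)
    then show ?thesis by (simp add: bit_iff_odd)
  qed
qed

(* The reduced matrix of a state is again a state. *)
lemma density_matrix_reduced_AB:
  assumes rho: "density_matrix (2 ^ N) \<rho>" and i: "1 \<le> i" "i < N"
  shows "density_matrix 4 (reduced_AB N i \<rho>)"
proof -
  define d where "d = (2::nat) ^ N"
  define p where "p x = 2 * qubit_value N 0 x + qubit_value N i x" for x
  define J where "J = {1..<N} - {i}"
  define q where "q x = (\<lambda>j. if j \<in> J then qubit_value N j x else 0)" for x
  define Z where "Z = q ` {..<d}"
  have p4: "p x < 4" for x
    using qubit_value_lt_2[of N 0 x] qubit_value_lt_2[of N i x] unfolding p_def by linarith
  have p_iff: "qubit_value N 0 x = r div 2 \<and> qubit_value N i x = r mod 2 \<longleftrightarrow> p x = r" for x r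
    using qubit_value_lt_2[of N i x] unfolding p_def by (smt (verit) div_mult_mod_eq div_mult_self3 div_less mod_less mod_mult_self4 mult.commute add.commute add_cancel_right_left zero_neq_numeral)
  have q_iff: "(\<forall>j \<in> J. qubit_value N j x = qubit_value N j y) \<longleftrightarrow> q x = q y" for x y
    unfolding q_def by (auto simp: fun_eq_iff)
  have R: "reduced_AB N i \<rho> $$ (r, c) =
      (\<Sum>x<d. \<Sum>y<d. if p x = r \<and> p y = c \<and> q x = q y then \<rho> $$ (x, y) else 0)"
    if "r < 4" "c < 4" for r c
  proof -
    have S: "{(x, y). x < 2 ^ N \<and> y < 2 ^ N \<and>
         qubit_value N 0 x = r div 2 \<and> qubit_value N i x = r mod 2 \<and>
         qubit_value N 0 y = c div 2 \<and> qubit_value N i y = c mod 2 \<and>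
         (\<forall>j \<in> {1..<N} - {i}. qubit_value N j x = qubit_value N j y)}
       = {z \<in> {..<d} \<times> {..<d}. case z of (x, y) \<Rightarrow> p x = r \<and> p y = c \<and> q x = q y}"
      unfolding q_iff[symmetric] p_iff[symmetric] d_def J_def by auto
    show ?thesis
      using that unfolding reduced_AB_def
      by (simp only: index_mat S split_conv sum.cartesian_product)
        (subst sum.inter_filter, auto intro!: sum.cong)
  qed
  have carr: "\<rho> \<in> carrier_mat d d" and tr: "(\<Sum>x<d. \<rho> $$ (x, x)) = 1"
    and pos: "\<And>v. v \<in> carrier_vec d \<Longrightarrow> 0 \<le> (\<rho> *\<^sub>v v) \<bullet>c v"
    using rho by (auto simp: density_matrix_def d_def)
  have form: "(M *\<^sub>v v) \<bullet>c v = (\<Sum>r<n. \<Sum>c<n. M $$ (r, c) * v $ c * cnj (v $ r))"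
    if "M \<in> carrier_mat n n" "v \<in> carrier_vec n" for M v n
    using that by (auto simp: scalar_prod_def sum_distrib_right lessThan_atLeast0 intro!: sum.cong)
  have carrR: "reduced_AB N i \<rho> \<in> carrier_mat 4 4" by (simp add: reduced_AB_def)
  have "0 \<le> (reduced_AB N i \<rho> *\<^sub>v v) \<bullet>c v" if v: "v \<in> carrier_vec 4" for v
  proof -
    define w where "w z = vec d (\<lambda>x. if q x = z then v $ p x else 0)" for z
    have "(reduced_AB N i \<rho> *\<^sub>v v) \<bullet>c v =
        (\<Sum>r<4. \<Sum>c<4. \<Sum>x<d. \<Sum>y<d. if p x = r \<and> p y = c \<and> q x = q y
           then \<rho> $$ (x, y) * v $ c * cnj (v $ r) else 0)"
      unfolding form[OF carrR v]
      by (intro sum.cong refl) (auto simp: R sum_distrib_right intro!: sum.cong)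
    also have "\<dots> = (\<Sum>r<4. \<Sum>x<d. \<Sum>y<d. \<Sum>c<4. if p x = r \<and> p y = c \<and> q x = q y
           then \<rho> $$ (x, y) * v $ c * cnj (v $ r) else 0)"
    proof (rule sum.cong[OF refl], goal_cases)
      case (1 r)
      show ?case
        by (subst sum.swap) (intro sum.cong refl sum.swap)
    qed
    also have "\<dots> = (\<Sum>x<d. \<Sum>y<d. \<Sum>r<4. \<Sum>c<4. if p x = r \<and> p y = c \<and> q x = q y
           then \<rho> $$ (x, y) * v $ c * cnj (v $ r) else 0)"
      by (subst sum.swap) (intro sum.cong refl sum.swap)
    also have "\<dots> = (\<Sum>x<d. \<Sum>y<d. \<Sum>r<4. if p x = r then \<Sum>c<4. if p y = c
           then if q x = q y then \<rho> $$ (x, y) * v $ c * cnj (v $ r) else 0 else 0 else 0)"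
      by (intro sum.cong refl) auto
    also have "\<dots> = (\<Sum>x<d. \<Sum>y<d. if q x = q y
           then \<rho> $$ (x, y) * v $ p y * cnj (v $ p x) else 0)"
      by (simp add: p4)
    also have "\<dots> = (\<Sum>x<d. \<Sum>y<d. \<Sum>z\<in>Z. if q x = z then
           if q x = q y then \<rho> $$ (x, y) * v $ p y * cnj (v $ p x) else 0 else 0)"
      by (intro sum.cong refl) (simp add: Z_def)
    also have "\<dots> = (\<Sum>x<d. \<Sum>y<d. \<Sum>z\<in>Z. \<rho> $$ (x, y) * w z $ y * cnj (w z $ x))"
      by (intro sum.cong refl) (auto simp: w_def)
    also have "\<dots> = (\<Sum>x<d. \<Sum>z\<in>Z. \<Sum>y<d. \<rho> $$ (x, y) * w z $ y * cnj (w z $ x))"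
      by (intro sum.cong refl sum.swap)
    also have "\<dots> = (\<Sum>z\<in>Z. \<Sum>x<d. \<Sum>y<d. \<rho> $$ (x, y) * w z $ y * cnj (w z $ x))"
      by (rule sum.swap)
    also have "\<dots> = (\<Sum>z\<in>Z. (\<rho> *\<^sub>v w z) \<bullet>c w z)"
      by (intro sum.cong refl form[OF carr, symmetric]) (simp add: w_def)
    also have "\<dots> \<ge> 0"
      by (intro sum_nonneg pos) (simp add: w_def)
    finally show ?thesis .
  qed
  moreover have "(\<Sum>r<4. reduced_AB N i \<rho> $$ (r, r)) = 1"
  proof -
    have eq: "p x = p y \<and> q x = q y \<longleftrightarrow> x = y" if "x < d" "y < d" for x y
    proof
      assume pq: "p x = p y \<and> q x = q y"
      have same: "qubit_value N 0 x = qubit_value N 0 y" "qubit_value N i x = qubit_value N i y"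
        using p_iff[of x "p y"] p_iff[of y "p y"] pq by simp_all
      show "x = y"
      proof (rule qubit_value_inj)
        fix k assume "k < N"
        then consider "k = 0" | "k = i" | "k \<in> J" unfolding J_def by force
        then show "qubit_value N k x = qubit_value N k y"
          using same pq q_iff[of x y] by cases auto
      qed (use that in \<open>auto simp: d_def\<close>)
    qed auto
    have "(\<Sum>r<4. reduced_AB N i \<rho> $$ (r, r)) =
      (\<Sum>r<4. \<Sum>x<d. \<Sum>y<d. if x = y then if p x = r then \<rho> $$ (x, x) else 0 else 0)"
    proof (rule sum.cong[OF refl], goal_cases)
      case (1 r)
      have "(if p x = r \<and> p y = r \<and> q x = q y then \<rho> $$ (x, y) else 0) =
          (if x = y then if p x = r then \<rho> $$ (x, x) else 0 else 0)" if "x < d" "y < d" for x y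
        using eq[OF that] by auto
      then show ?case using 1 by (simp add: R)
    qed
    also have "\<dots> = (\<Sum>x<d. \<Sum>r<4. if p x = r then \<rho> $$ (x, x) else 0)"
      by (subst sum.swap) simp
    also have "\<dots> = 1" using tr p4 by simp
    finally show ?thesis .
  qed
  ultimately show ?thesis
    using carrR by (simp add: density_matrix_def)
qed

end

theory Submission
  imports Defs "HOL-Analysis.Convex"
begin

text \<open>
  With \<open>t = \<beta> / \<delta> \<ge> 1\<close> and \<open>u = s / a\<close>, convexity of \<open>x \<mapsto> x\<^sup>t\<close> with
  weights \<open>1 / (1 + u)\<close> and \<open>u / (1 + u)\<close> gives
  \<open>(x + y)\<^sup>t \<le> (1 + u)\<^sup>t\<^sup>-\<^sup>1 x\<^sup>t + (1 + 1/u)\<^sup>t\<^sup>-\<^sup>1 y\<^sup>t\<close>. Splitting off the last summand of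
  \<open>\<Sum>i. \<E>\<^sub>i\<^sup>\<delta>\<close> repeatedly, each step multiplies the coefficients of the earlier summands by
  \<open>(1 + u)\<^sup>t\<^sup>-\<^sup>1\<close>, which is the asserted bound.
\<close>

lemma powr_add_le_weighted:
  fixes x y t u :: real
  assumes "x \<ge> 0" "y \<ge> 0" "t \<ge> 1" "u > 0"
  shows "(x + y) powr t \<le> (1 + u) powr (t - 1) * x powr t + (1 + 1 / u) powr (t - 1) * y powr t"
proof -
  \<comment> \<open>Coefficients of at least 1 settle the cases \<open>x = 0\<close> and
    \<open>y = 0\<close>, so convexity is applied to positive arguments only.\<close>
  have ge1: "1 \<le> (1 + u) powr (t - 1)" "1 \<le> (1 + 1 / u) powr (t - 1)"
    using assms by (auto intro!: ge_one_powr_ge_zero)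
  consider "x = 0" | "y = 0" | "x > 0" "y > 0"
    using assms by fastforce
  then show ?thesis
  proof cases
    case 1
    then show ?thesis
      using mult_right_mono[OF ge1(2), of "y powr t"] by simp
  next
    case 2
    then show ?thesis
      using mult_right_mono[OF ge1(1), of "x powr t"] by simp
  next
    case 3
    \<comment> \<open>The reciprocals of \<open>1 + u\<close> and \<open>v\<close> sum to 1, so
      \<open>x + y\<close> is a convex combination of \<open>(1 + u) * x\<close> and
      \<open>v * y\<close>.\<close>
    define v where "v = 1 + 1 / u"
    have pos: "1 + u > 0" "v > 0"
      using assms by (auto simp: v_def add_pos_pos)
    have w: "1 - 1 / v = 1 / (1 + u)"
      using assms by (simp add: v_def field_simps)
    have scale: "1 / c * (c * z) powr t = c powr (t - 1) * z powr t" if "c > 0" "z > 0" for c z :: real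
      using that by (simp add: powr_mult powr_diff)
    have v1: "1 / v \<le> 1" "0 \<le> 1 / v"
      using assms by (simp_all add: v_def divide_simps)
    have "((1 - 1 / v) *\<^sub>R ((1 + u) * x) + (1 / v) *\<^sub>R (v * y)) powr t
        \<le> (1 - 1 / v) * ((1 + u) * x) powr t + 1 / v * (v * y) powr t"
      using v1 pos 3 assms by (intro convex_onD[OF powr_convex]) auto
    moreover have "(1 - 1 / v) *\<^sub>R ((1 + u) * x) + (1 / v) *\<^sub>R (v * y) = x + y"
      using pos by (simp add: w)
    ultimately show ?thesis
      unfolding w using scale[OF pos(1) 3(1)] scale[OF pos(2) 3(2)] by (simp add: v_def)
  qed
qed

lemma powr_sum_le_weighted:
  fixes x :: "nat \<Rightarrow> real" and t u :: real
  assumes "\<And>i. x i \<ge> 0" "t \<ge> 1" "u > 0"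
  shows "(\<Sum>i = 1..n. x i) powr t \<le>
    (1 + 1 / u) powr (t - 1) * (\<Sum>i = 1..n. ((1 + u) powr (t - 1)) ^ (n - i) * x i powr t)"
proof (induction n)
  case 0
  show ?case by simp
next
  case (Suc n)
  define c d where "c = (1 + u) powr (t - 1)" and "d = (1 + 1 / u) powr (t - 1)"
  have "(\<Sum>i = 1..Suc n. x i) powr t \<le> c * (\<Sum>i = 1..n. x i) powr t + d * x (Suc n) powr t"
    using powr_add_le_weighted[of "\<Sum>i = 1..n. x i" "x (Suc n)" t u] assms
    by (simp add: sum_nonneg c_def d_def)
  also have "\<dots> \<le> c * (d * (\<Sum>i = 1..n. c ^ (n - i) * x i powr t)) + d * x (Suc n) powr t"
    using Suc.IH by (simp add: c_def d_def mult_left_mono)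
  also have "\<dots> = d * (\<Sum>i = 1..Suc n. c ^ (Suc n - i) * x i powr t)"
  proof -
    \<comment> \<open>For \<open>i \<le> n\<close> the factor \<open>c\<close> raises the exponent
      \<open>n - i\<close> by one; the new last term has exponent 0.\<close>
    have "c * (\<Sum>i = 1..n. c ^ (n - i) * x i powr t) = (\<Sum>i = 1..n. c ^ (Suc n - i) * x i powr t)"
      by (auto simp: sum_distrib_left Suc_diff_le intro!: sum.cong)
    then show ?thesis
      by (simp add: algebra_simps)
  qed
  finally show ?case
    by (simp add: c_def d_def)
qed

theorem theorem2p6:
  fixes N :: nat and \<delta> a \<beta> s :: real
    and E :: "nat \<Rightarrow> nat \<Rightarrow> complex mat \<Rightarrow> real"
    and \<rho> :: "complex mat"
    and \<pi> :: "nat \<Rightarrow> nat" and e :: "nat \<Rightarrow> real"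
  assumes "N \<ge> 2"
    and "0 < \<delta>" and "\<delta> \<le> 1"
    and "bipartite_measure E"
    and "polygamous E N \<delta>"
    and "density_matrix (2 ^ N) \<rho>"
    and "\<pi> permutes {1..N - 1}"
    and "\<And>i. i \<in> {1..N - 1} \<Longrightarrow> e i = measure_AB E N (\<pi> i) \<rho>"
    and "\<And>i. i \<in> {1..N - 2} \<Longrightarrow> e i \<ge> e (i + 1)"
    and "a \<ge> 1"
    and "\<And>i. i \<in> {1..N - 2} \<Longrightarrow> e i powr \<delta> \<ge> a * e (i + 1) powr \<delta>"
    and "\<beta> \<ge> \<delta>" and "s > 0"
  shows "measure_A_rest E N \<rho> powr \<beta> \<le>
    (1 + a / s) powr (\<beta> / \<delta> - 1) *
    (\<Sum>i = 1..N - 1. ((1 + s / a) powr (\<beta> / \<delta> - 1)) ^ (N - 1 - i) * e i powr \<beta>)"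
proof -
  define t where "t = \<beta> / \<delta>"
  have t: "t \<ge> 1" "\<delta> * t = \<beta>"
    using assms(2,12) by (auto simp: t_def)
  have "measure_A_rest E N \<rho> powr \<delta> \<le> (\<Sum>i = 1..N - 1. measure_AB E N i \<rho> powr \<delta>)"
    using assms(5,6) by (simp add: polygamous_def)
  \<comment> \<open>Sorting only permutes the summands.\<close>
  also have "\<dots> = (\<Sum>i = 1..N - 1. measure_AB E N (\<pi> i) \<rho> powr \<delta>)"
    by (rule sum.reindex_bij_betw[OF permutes_imp_bij[OF assms(7)], symmetric])
  also have "\<dots> = (\<Sum>i = 1..N - 1. e i powr \<delta>)"
    using assms(8) by simp
  finally have "(measure_A_rest E N \<rho> powr \<delta>) powr t \<le> (\<Sum>i = 1..N - 1. e i powr \<delta>) powr t"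
    using t(1) by (intro powr_mono2) auto
  \<comment> \<open>Take \<open>u = s / a\<close> and the terms \<open>e i powr \<delta>\<close>,
    which are nonnegative at every index, even outside \<open>{1..N - 1}\<close>. Since
    \<open>\<delta> * t = \<beta>\<close>, the iterated powers then collapse to exponent
    \<open>\<beta>\<close>.\<close>
  also have "\<dots> \<le> (1 + 1 / (s / a)) powr (t - 1) *
      (\<Sum>i = 1..N - 1. ((1 + s / a) powr (t - 1)) ^ (N - 1 - i) * (e i powr \<delta>) powr t)"
    using t(1) assms(10,13) by (intro powr_sum_le_weighted) auto
  finally show ?thesis
    by (simp add: powr_powr t(2)) (simp add: t_def)
qed

end
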